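(* Let $n\ge1$, $k\in\{1,\dots,n\}$, and let $\phi\in\mathrm{Val}$ be $k$-strictly monotone. If $\phi$ is $1$-homogeneous, then $(\mathcal{K}^n,\rho_\phi)$ is a length space, and for any given $K,L\in\mathcal{K}^n$ there is a shortest path $\gamma:[a,b]\to\mathcal{K}^n$ joining $K$ and $L$.
   Context: $\mathcal{K}^n$ is the set of nonempty compact convex subsets of $\mathbb{R}^n$, with the Hausdorff distance; $\mathcal{K}^n_k$ is the subset of those with affine dimension at least $k$. A valuation is a function $\phi:\mathcal{K}^n\to\mathbb{R}$ with $\phi(K\cup L)+\phi(K\cap L)=\phi(K)+\phi(L)$ whenever $K,L,K\cup L\in\mathcal{K}^n$, with the convention $\phi(\varnothing)=0$. $\mathrm{Val}$ is the space of valuations that are continuous (for the Hausdorff distance) and translation-invariant. $\phi$ is $1$-homogeneous if $\phi(tK)=t\phi(K)$ for all $t\ge0$, $K\in\mathcal{K}^n$. $\phi$ is $k$-strictly monotone if $K\subsetneq L$ implies $\phi(K)<\phi(L)$ for all $K,L\in\mathcal{K}^n_k\cup\{\varnothing\}$. The join-deviation is $\rho_\phi(K,L)=2\phi(K\tilde\cup L)-\phi(K)-\phi(L)$ for $K,L\in\mathcal{K}^n$, where $K\tilde\cup L$ is the convex hull of $K\cup L$; in the present case it is a metric on $\mathcal{K}^n$. In a metric space $(X,d)$, the length of a continuous path $\gamma:[a,b]\to X$ is $L(\gamma)=\sup\sum_{i=1}^N d(\gamma(p_{i-1}),\gamma(p_i))$ over partitions $\{p_i\}_{i=0}^N$ of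 $[a,b]$; $\gamma$ is rectifiable if this is finite. If any two points can be joined by a rectifiable path, the induced intrinsic metric is $\overline d(x,y)=\inf\{L(\gamma):\gamma\text{ rectifiable from }x\text{ to }y\}$. A rectifiable path $\gamma$ from $x$ to $y$ is a shortest path if $L(\gamma)=\overline d(x,y)$. $(X,d)$ is a length space if $\overline d=d$. *)

theory Defs
  imports "HOL-Analysis.Analysis"
begin

section \<open>Length structures on metric spaces\<close>

context Metric_space
begin

definition path_between :: "real \<Rightarrow> real \<Rightarrow> (real \<Rightarrow> 'a) \<Rightarrow> 'a \<Rightarrow> 'a \<Rightarrow> bool" where
  "path_between a b \<gamma> x y \<longleftrightarrow>
     a < b \<and> continuous_map (top_of_set {a..b}) mtopology \<gamma> \<and> \<gamma> a = x \<and> \<gamma> b = y"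

definition partition_of :: "real \<Rightarrow> real \<Rightarrow> nat \<Rightarrow> (nat \<Rightarrow> real) \<Rightarrow> bool" where
  "partition_of a b N p \<longleftrightarrow> p 0 = a \<and> p N = b \<and> (\<forall>i<N. p i \<le> p (Suc i))"

definition path_length :: "real \<Rightarrow> real \<Rightarrow> (real \<Rightarrow> 'a) \<Rightarrow> ereal" where
  "path_length a b \<gamma> =
     Sup {ereal (\<Sum>i=1..N. d (\<gamma> (p (i - 1))) (\<gamma> (p i))) | N p. partition_of a b N p}"

definition rectifiable_path :: "real \<Rightarrow> real \<Rightarrow> (real \<Rightarrow> 'a) \<Rightarrow> 'a \<Rightarrow> 'a \<Rightarrow> bool" where
  "rectifiable_path a b \<gamma> x y \<longleftrightarrow> path_between a b \<gamma> x y \<and> path_length a b \<gamma> < \<infinity>"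

definition rectifiably_connected :: bool where
  "rectifiably_connected \<longleftrightarrow> (\<forall>x\<in>M. \<forall>y\<in>M. \<exists>a b \<gamma>. rectifiable_path a b \<gamma> x y)"

definition intrinsic_dist :: "'a \<Rightarrow> 'a \<Rightarrow> ereal" where
  "intrinsic_dist x y = Inf {path_length a b \<gamma> | a b \<gamma>. rectifiable_path a b \<gamma> x y}"

definition shortest_path :: "real \<Rightarrow> real \<Rightarrow> (real \<Rightarrow> 'a) \<Rightarrow> 'a \<Rightarrow> 'a \<Rightarrow> bool" where
  "shortest_path a b \<gamma> x y \<longleftrightarrow>
     rectifiable_path a b \<gamma> x y \<and> path_length a b \<gamma> = intrinsic_dist x y"

definition length_space :: bool where
  "length_space \<longleftrightarrow>
     rectifiably_connected \<and> (\<forall>x\<in>M. \<forall>y\<in>M. intrinsic_dist x y = ereal (d x y))"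

end

section \<open>Convex bodies\<close>

definition convex_bodies :: "(real ^ 'n) set set" where
  "convex_bodies = {K. K \<noteq> {} \<and> compact K \<and> convex K}"

definition convex_bodies_dim_ge :: "nat \<Rightarrow> (real ^ 'n) set set" where
  "convex_bodies_dim_ge k = {K \<in> convex_bodies. aff_dim K \<ge> int k}"

text \<open>
  The locale \<^locale>\<open>Metric_space\<close> asks for nonnegativity and symmetry on the whole type, so
  the distances on convex bodies below are set to 0 outside of their domain of definition.
\<close>

definition hausdorff_dist :: "(real ^ 'n) set \<Rightarrow> (real ^ 'n) set \<Rightarrow> real" where
  "hausdorff_dist K L =
     (if K \<in> convex_bodies \<and> L \<in> convex_bodies
      then max (SUP x\<in>K. infdist x L) (SUP y\<in>L. infdist y K) else 0)"

lemma hausdorff_dist_commute: "hausdorff_dist K L = hausdorff_dist L K"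
  by (simp add: hausdorff_dist_def max.commute conj_commute)

lemma infdist_le_hausdorff_dist:
  assumes "K \<in> convex_bodies" "L \<in> convex_bodies" "x \<in> K"
  shows "infdist x L \<le> hausdorff_dist K L"
proof -
  have "compact ((\<lambda>x. infdist x L) ` K)"
    using assms by (intro compact_continuous_image continuous_intros) (auto simp: convex_bodies_def)
  then have "bdd_above ((\<lambda>x. infdist x L) ` K)"
    by (simp add: bounded_imp_bdd_above compact_imp_bounded)
  then have "infdist x L \<le> (SUP x\<in>K. infdist x L)"
    using assms by (intro cSUP_upper)
  then show ?thesis using assms by (simp add: hausdorff_dist_def)
qed

lemma hausdorff_dist_le:
  assumes "K \<in> convex_bodies" "L \<in> convex_bodies"
    and "\<And>x. x \<in> K \<Longrightarrow> infdist x L \<le> c" "\<And>y. y \<in> L \<Longrightarrow> infdist y K \<le> c"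
  shows "hausdorff_dist K L \<le> c"
  using assms by (auto simp: hausdorff_dist_def convex_bodies_def intro!: cSUP_least)

lemma infdist_le_hausdorff_dist_triangle:
  assumes K: "K \<in> convex_bodies" "x \<in> K" and L: "L \<in> convex_bodies" and M: "M \<in> convex_bodies"
  shows "infdist x M \<le> hausdorff_dist K L + hausdorff_dist L M"
proof -
  have "closed L" "L \<noteq> {}" using L compact_imp_closed by (auto simp: convex_bodies_def)
  then obtain y where y: "y \<in> L" "infdist x L = dist x y"
    using infdist_attains_inf by blast
  have "infdist x M \<le> infdist y M + dist x y"
    by (rule infdist_triangle)
  also have "\<dots> \<le> hausdorff_dist L M + hausdorff_dist K L"
    using infdist_le_hausdorff_dist[OF L M y(1)] infdist_le_hausdorff_dist[OF K(1) L K(2)] y(2)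
    by simp
  finally show ?thesis by simp
qed

lemma Metric_space_hausdorff_dist:
  "Metric_space (convex_bodies :: (real ^ 'n) set set) hausdorff_dist"
proof
  fix K L :: "(real ^ 'n) set"
  show "hausdorff_dist K L = hausdorff_dist L K" by (rule hausdorff_dist_commute)
  show "0 \<le> hausdorff_dist K L"
  proof (cases "K \<in> convex_bodies \<and> L \<in> convex_bodies")
    case True
    then obtain x where "x \<in> K" by (auto simp: convex_bodies_def)
    with True have "infdist x L \<le> hausdorff_dist K L" by (simp add: infdist_le_hausdorff_dist)
    with infdist_nonneg[of x L] show ?thesis by linarith
  qed (auto simp: hausdorff_dist_def)
next
  fix K L :: "(real ^ 'n) set"
  assume K: "K \<in> convex_bodies" and L: "L \<in> convex_bodies"
  have sub: "A \<subseteq> B"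
    if "A \<in> convex_bodies" "B \<in> convex_bodies" "hausdorff_dist A B = 0" for A B :: "(real ^ 'n) set"
  proof
    fix x assume "x \<in> A"
    with that have "infdist x B \<le> 0" using infdist_le_hausdorff_dist by metis
    then have "infdist x B = 0" using infdist_nonneg[of x B] by linarith
    then show "x \<in> B"
      using that in_closed_iff_infdist_zero[of B x] compact_imp_closed
      by (auto simp: convex_bodies_def)
  qed
  show "hausdorff_dist K L = 0 \<longleftrightarrow> K = L"
  proof
    assume "hausdorff_dist K L = 0"
    then show "K = L" using sub[OF K L] sub[OF L K] hausdorff_dist_commute[of K L] by auto
  next
    assume "K = L"
    then show "hausdorff_dist K L = 0"
      using K by (simp add: hausdorff_dist_def convex_bodies_def)
  qed
next
  fix K L M :: "(real ^ 'n) set"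
  assume K: "K \<in> convex_bodies" and L: "L \<in> convex_bodies" and M: "M \<in> convex_bodies"
  show "hausdorff_dist K M \<le> hausdorff_dist K L + hausdorff_dist L M"
    using infdist_le_hausdorff_dist_triangle[OF K _ L M]
      infdist_le_hausdorff_dist_triangle[OF M _ L K]
    by (intro hausdorff_dist_le[OF K M]) (auto simp: hausdorff_dist_commute add.commute)
qed

section \<open>Valuations\<close>

definition valuation :: "((real ^ 'n) set \<Rightarrow> real) \<Rightarrow> bool" where
  "valuation \<phi> \<longleftrightarrow> \<phi> {} = 0 \<and>
     (\<forall>K\<in>convex_bodies. \<forall>L\<in>convex_bodies. K \<union> L \<in> convex_bodies \<longrightarrow>
        \<phi> (K \<union> L) + \<phi> (K \<inter> L) = \<phi> K + \<phi> L)"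

definition translation_invariant :: "((real ^ 'n) set \<Rightarrow> real) \<Rightarrow> bool" where
  "translation_invariant \<phi> \<longleftrightarrow> (\<forall>K\<in>convex_bodies. \<forall>x. \<phi> ((+) x ` K) = \<phi> K)"

definition Val :: "((real ^ 'n) set \<Rightarrow> real) set" where
  "Val = {\<phi>. valuation \<phi> \<and>
     continuous_map (Metric_space.mtopology convex_bodies hausdorff_dist) euclideanreal \<phi> \<and>
     translation_invariant \<phi>}"

definition one_homogeneous :: "((real ^ 'n) set \<Rightarrow> real) \<Rightarrow> bool" where
  "one_homogeneous \<phi> \<longleftrightarrow> (\<forall>K\<in>convex_bodies. \<forall>t\<ge>0. \<phi> ((*\<^sub>R) t ` K) = t * \<phi> K)"

definition strictly_monotone :: "nat \<Rightarrow> ((real ^ 'n) set \<Rightarrow> real) \<Rightarrow> bool" where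
  "strictly_monotone k \<phi> \<longleftrightarrow>
     (\<forall>K \<in> convex_bodies_dim_ge k \<union> {{}}. \<forall>L \<in> convex_bodies_dim_ge k \<union> {{}}.
        K \<subset> L \<longrightarrow> \<phi> K < \<phi> L)"

definition join_deviation ::
  "((real ^ 'n) set \<Rightarrow> real) \<Rightarrow> (real ^ 'n) set \<Rightarrow> (real ^ 'n) set \<Rightarrow> real" where
  "join_deviation \<phi> K L =
     (if K \<in> convex_bodies \<and> L \<in> convex_bodies
      then 2 * \<phi> (convex hull (K \<union> L)) - \<phi> K - \<phi> L else 0)"

end

theory Submission
  imports Defs
begin

text \<open>
  Everything rests on one fact: a continuous translation-invariant valuation that is
  1-homogeneous is Minkowski additive, \<open>\<phi> (K + L) = \<phi> K + \<phi> L\<close> (lemma \<open>set_plus\<close>). Given this,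
  \<open>\<phi>\<close> behaves like an integral of support functions, and the join-deviation, because of
  \<open>2 * max a b - a - b = \<bar>a - b\<bar>\<close>, like an \<open>L\<^sup>1\<close> distance between them. In particular the
  Minkowski segment \<open>t \<mapsto> (1 - t) K + t L\<close> runs at constant speed from \<open>K\<close> to \<open>L\<close>, since for
  \<open>s \<le> t\<close> its points at times \<open>s\<close> and \<open>t\<close> are \<open>(t - s) K\<close> and \<open>(t - s) L\<close>, each enlarged by the
  same summand \<open>(1 - t) K + s L\<close>. A path of constant speed has length equal to the distance of
  its endpoints, so it is shortest and the space is a length space.

  The metric axioms follow from additivity too. The triangle inequality is the inclusion
  \<open>(K \<squnion> M) + L \<subseteq> (K \<squnion> L) + (L \<squnion> M)\<close>, where \<open>\<squnion>\<close> is the convex hull of the union, and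
  definiteness is strict monotonicity on all convex bodies; the latter is only assumed in
  dimension at least \<open>k\<close>, but adding a ball to both bodies makes them full-dimensional, preserves
  strict inclusion and changes both values by the same amount.

  Additivity is proved by letting the class of bodies \<open>P\<close> with \<open>\<phi> (Q + P) = \<phi> Q + \<phi> P\<close> for all
  \<open>Q\<close> grow. It contains the points, and with \<open>K\<close> it contains every pyramid \<open>T\<close> over \<open>K\<close>. For an
  apex at the origin, the doubled pyramid \<open>2 T\<close> is the union of \<open>T\<close> and \<open>T + K\<close>, which meet
  exactly in \<open>K\<close>. Applying the valuation property after adding \<open>Q\<close>, and additivity of \<open>K\<close>, gives
  \<open>\<phi> (Q + 2 T) = 2 * \<phi> (Q + T) - \<phi> Q\<close>. By homogeneity this says that the increment
  \<open>\<phi> (Q + T) - \<phi> Q\<close> does not change when \<open>Q\<close> is halved, and letting \<open>Q\<close> shrink to a point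
  identifies it as \<open>\<phi> T\<close>. A polytope is reached from a vertex by finitely many pyramids, and
  general bodies are limits of polytopes.
\<close>

section \<open>Geodesics of constant speed\<close>

context Metric_space
begin

lemma dist_le_path_length:
  assumes "a \<le> b"
  shows "ereal (d (\<gamma> a) (\<gamma> b)) \<le> path_length a b \<gamma>"
  unfolding path_length_def
proof (rule Sup_upper, rule CollectI, intro exI conjI)
  show "partition_of a b 1 (\<lambda>i. if i = 0 then a else b)"
    using assms by (simp add: partition_of_def)
qed simp

lemma dist_le_intrinsic_dist: "ereal (d x y) \<le> intrinsic_dist x y"
  unfolding intrinsic_dist_def
proof (rule Inf_greatest)
  fix l assume "l \<in> {path_length a b \<gamma> |a b \<gamma>. rectifiable_path a b \<gamma> x y}"
  then obtain a b \<gamma> where "l = path_length a b \<gamma>" "rectifiable_path a b \<gamma> x y" by auto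
  then show "ereal (d x y) \<le> l"
    using dist_le_path_length[of a b \<gamma>] by (auto simp: rectifiable_path_def path_between_def)
qed

text \<open>
  Along a path of constant speed the sums over all partitions telescope to the same value.
\<close>

lemma constant_speed_path:
  assumes M: "\<And>t. t \<in> {0..1} \<Longrightarrow> \<gamma> t \<in> M"
    and speed: "\<And>s t. 0 \<le> s \<Longrightarrow> s \<le> t \<Longrightarrow> t \<le> 1 \<Longrightarrow> d (\<gamma> s) (\<gamma> t) = (t - s) * d (\<gamma> 0) (\<gamma> 1)"
  shows "rectifiable_path 0 1 \<gamma> (\<gamma> 0) (\<gamma> 1)"
    and "path_length 0 1 \<gamma> = ereal (d (\<gamma> 0) (\<gamma> 1))"
proof -
  let ?D = "d (\<gamma> 0) (\<gamma> 1)"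
  have sum: "(\<Sum>i=1..N. d (\<gamma> (p (i - 1))) (\<gamma> (p i))) = ?D" if p: "partition_of 0 1 N p" for N p
  proof -
    have mono: "p i \<le> p j" if "i \<le> j" "j \<le> N" for i j
      using that
    proof (induction j rule: dec_induct)
      case (step j)
      then show ?case using p by (auto simp: partition_of_def intro: order_trans)
    qed simp
    have "(\<Sum>i=1..N. d (\<gamma> (p (i - 1))) (\<gamma> (p i))) = (\<Sum>i=1..N. (p i - p (i - 1)) * ?D)"
    proof (rule sum.cong)
      fix i assume "i \<in> {1..N}"
      then show "d (\<gamma> (p (i - 1))) (\<gamma> (p i)) = (p i - p (i - 1)) * ?D"
        using mono[of 0 "i - 1"] mono[of "i - 1" i] mono[of i N] p
        by (intro speed) (auto simp: partition_of_def)
    qed simp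
    also have "\<dots> = (\<Sum>i=1..N. p i - p (i - 1)) * ?D" by (simp add: sum_distrib_right)
    also have "(\<Sum>i=1..N. p i - p (i - 1)) = p N - p 0"
      by (induction N) auto
    finally show ?thesis using p by (simp add: partition_of_def)
  qed
  have "partition_of 0 1 1 (\<lambda>i. if i = 0 then 0 else 1)" by (simp add: partition_of_def)
  with sum have "{ereal (\<Sum>i=1..N. d (\<gamma> (p (i - 1))) (\<gamma> (p i))) |N p. partition_of 0 1 N p} = {ereal ?D}"
    by (auto simp: set_eq_iff) metis
  then show len: "path_length 0 1 \<gamma> = ereal ?D" by (simp add: path_length_def)
  have abs: "d (\<gamma> s) (\<gamma> t) = \<bar>t - s\<bar> * ?D" if "s \<in> {0..1}" "t \<in> {0..1}" for s t
    using speed[of s t] speed[of t s] that commute[of "\<gamma> s" "\<gamma> t"] by (cases "s \<le> t") auto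
  have "continuous_map (top_of_set {0..1}) mtopology \<gamma>"
    unfolding continuous_map_to_metric
  proof (intro ballI allI impI)
    fix t \<epsilon> :: real assume t: "t \<in> topspace (top_of_set {0..1})" and "\<epsilon> > 0"
    let ?U = "{0..1} \<inter> ball t (\<epsilon> / (?D + 1))"
    have D: "?D + 1 > 0" using nonneg[of "\<gamma> 0" "\<gamma> 1"] by linarith
    show "\<exists>U. openin (top_of_set {0..1}) U \<and> t \<in> U \<and> (\<forall>s\<in>U. \<gamma> s \<in> mball (\<gamma> t) \<epsilon>)"
    proof (intro exI conjI ballI)
      show "openin (top_of_set {0..1}) ?U" by blast
      show "t \<in> ?U" using t \<open>\<epsilon> > 0\<close> D by simp
      fix s assume s: "s \<in> ?U"
      then have "\<bar>s - t\<bar> * (?D + 1) < \<epsilon>" using D by (simp add: dist_real_def field_simps abs_minus_commute)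
      moreover have "\<bar>s - t\<bar> * ?D \<le> \<bar>s - t\<bar> * (?D + 1)" by (intro mult_left_mono) auto
      ultimately show "\<gamma> s \<in> mball (\<gamma> t) \<epsilon>"
        using s t abs[of t s] M by (auto simp: in_mball)
    qed
  qed
  with len show "rectifiable_path 0 1 \<gamma> (\<gamma> 0) (\<gamma> 1)"
    by (simp add: rectifiable_path_def path_between_def)
qed

lemma length_space_if_constant_speed_paths:
  assumes "\<And>x y. x \<in> M \<Longrightarrow> y \<in> M \<Longrightarrow> \<exists>\<gamma>. \<gamma> 0 = x \<and> \<gamma> 1 = y \<and> (\<forall>t\<in>{0..1}. \<gamma> t \<in> M) \<and>
     (\<forall>s t. 0 \<le> s \<longrightarrow> s \<le> t \<longrightarrow> t \<le> 1 \<longrightarrow> d (\<gamma> s) (\<gamma> t) = (t - s) * d x y)"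
  shows "length_space" and "x \<in> M \<Longrightarrow> y \<in> M \<Longrightarrow> \<exists>a b \<gamma>. shortest_path a b \<gamma> x y"
proof -
  have path: "\<exists>\<gamma>. rectifiable_path 0 1 \<gamma> x y \<and> path_length 0 1 \<gamma> = ereal (d x y)"
    if xy: "x \<in> M" "y \<in> M" for x y
  proof -
    from assms[OF xy] obtain \<gamma> where \<gamma>: "\<gamma> 0 = x" "\<gamma> 1 = y" "\<And>t. t \<in> {0..1} \<Longrightarrow> \<gamma> t \<in> M"
      "\<And>s t. 0 \<le> s \<Longrightarrow> s \<le> t \<Longrightarrow> t \<le> 1 \<Longrightarrow> d (\<gamma> s) (\<gamma> t) = (t - s) * d x y" by blast
    from constant_speed_path[of \<gamma>] \<gamma> show ?thesis by auto
  qed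
  have intr: "intrinsic_dist x y = ereal (d x y)" if xy: "x \<in> M" "y \<in> M" for x y
  proof (rule antisym)
    from path[OF xy] obtain \<gamma> where
      "rectifiable_path 0 1 \<gamma> x y" "path_length 0 1 \<gamma> = ereal (d x y)" by blast
    then show "intrinsic_dist x y \<le> ereal (d x y)"
      unfolding intrinsic_dist_def by (intro Inf_lower) (metis (mono_tags, lifting) mem_Collect_eq)
  qed (rule dist_le_intrinsic_dist)
  show "length_space"
    unfolding length_space_def rectifiably_connected_def using path intr by blast
  show "\<exists>a b \<gamma>. shortest_path a b \<gamma> x y" if "x \<in> M" "y \<in> M"
    unfolding shortest_path_def using path[OF that] intr[OF that] by metis
qed

end

section \<open>Minkowski sums of convex sets\<close>

lemma scaleR_image_set_plus:
  fixes A B :: "'a::real_vector set"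
  shows "(*\<^sub>R) t ` (A + B) = (*\<^sub>R) t ` A + (*\<^sub>R) t ` B"
proof (intro equalityI subsetI)
  fix x assume "x \<in> (*\<^sub>R) t ` A + (*\<^sub>R) t ` B"
  then obtain a b where "a \<in> A" "b \<in> B" "x = t *\<^sub>R (a + b)"
    by (auto simp: scaleR_add_right elim!: set_plus_elim)
  then show "x \<in> (*\<^sub>R) t ` (A + B)" by blast
qed (auto simp: scaleR_add_right elim!: set_plus_elim intro!: set_plus_intro)

lemma scaleR_image_scaleR_image: "(*\<^sub>R) s ` (*\<^sub>R) t ` (A :: 'a::real_vector set) = (*\<^sub>R) (s * t) ` A"
  by (simp add: image_image)

lemma scaleR_image_one: "(*\<^sub>R) 1 ` (A :: 'a::real_vector set) = A"
  by simp

lemma scaleR_image_zero: "A \<noteq> {} \<Longrightarrow> (*\<^sub>R) 0 ` (A :: 'a::real_vector set) = 0"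
  by (auto simp: set_zero)

lemma convex_scaleR_sum_mem:
  fixes K :: "'a::real_vector set"
  assumes "convex K" "s \<ge> 0" "t \<ge> 0" "x \<in> K" "y \<in> K"
  shows "\<exists>z\<in>K. s *\<^sub>R x + t *\<^sub>R y = (s + t) *\<^sub>R z"
proof (cases "s + t = 0")
  case True
  with assms have "s = 0" "t = 0" by auto
  with assms show ?thesis by auto
next
  case False
  with assms have "s + t > 0" by auto
  then have "s *\<^sub>R x + t *\<^sub>R y = (s + t) *\<^sub>R ((s / (s + t)) *\<^sub>R x + (t / (s + t)) *\<^sub>R y)"
    by (simp add: scaleR_add_right)
  moreover have "(s / (s + t)) *\<^sub>R x + (t / (s + t)) *\<^sub>R y \<in> K"
    using assms \<open>s + t > 0\<close> by (intro convexD) (auto simp: add_divide_distrib[symmetric])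
  ultimately show ?thesis by blast
qed

lemma scaleR_image_add:
  fixes K :: "'a::real_vector set"
  assumes "convex K" "s \<ge> 0" "t \<ge> 0"
  shows "(*\<^sub>R) (s + t) ` K = (*\<^sub>R) s ` K + (*\<^sub>R) t ` K"
proof
  show "(*\<^sub>R) (s + t) ` K \<subseteq> (*\<^sub>R) s ` K + (*\<^sub>R) t ` K"
    by (auto simp: scaleR_add_left set_plus_def)
  show "(*\<^sub>R) s ` K + (*\<^sub>R) t ` K \<subseteq> (*\<^sub>R) (s + t) ` K"
    using convex_scaleR_sum_mem[OF assms] by (fastforce simp: set_plus_def)
qed

lemma convex_hull_Un_set_plus:
  assumes "convex C"
  shows "convex hull ((A + C) \<union> (B + C)) = convex hull (A \<union> B) + C"
  by (metis assms Un_set_plus convex_hull_set_plus convex_hull_eq)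

text \<open>
  If \<open>p + a = q + b\<close> with \<open>a \<in> A\<close> and \<open>b \<in> B\<close>, the segment from \<open>a\<close> to \<open>b\<close> stays in \<open>A \<union> B\<close>
  and, being connected, passes through \<open>A \<inter> B\<close>; the same convex combination of \<open>p\<close> and \<open>q\<close>
  compensates. Hence \<open>K \<mapsto> \<phi> (Q + K)\<close> is a valuation whenever \<open>\<phi>\<close> is.
\<close>

lemma set_plus_Int_of_convex_Un:
  fixes A B Q :: "'a::real_normed_vector set"
  assumes "convex Q" "closed A" "closed B" "convex (A \<union> B)"
  shows "(Q + A) \<inter> (Q + B) = Q + (A \<inter> B)"
proof
  show "(Q + A) \<inter> (Q + B) \<subseteq> Q + (A \<inter> B)"
  proof
    fix x assume "x \<in> (Q + A) \<inter> (Q + B)"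
    then obtain p a q b where x: "x = p + a" "x = q + b" and mem: "p \<in> Q" "q \<in> Q" "a \<in> A" "b \<in> B"
      by (meson IntD1 IntD2 set_plus_elim)
    have "closed_segment a b \<subseteq> A \<union> B"
      using assms mem by (intro closed_segment_subset) auto
    moreover have "connected (closed_segment a b)" by simp
    ultimately have "A \<inter> B \<inter> closed_segment a b \<noteq> {}"
      using connected_closedD[of "closed_segment a b" A B] assms mem by auto
    then obtain u where u: "0 \<le> u" "u \<le> 1" "(1 - u) *\<^sub>R a + u *\<^sub>R b \<in> A \<inter> B"
      by (auto simp: closed_segment_def)
    have "x = (1 - u) *\<^sub>R x + u *\<^sub>R x" by (simp add: algebra_simps)
    also have "\<dots> = (1 - u) *\<^sub>R (p + a) + u *\<^sub>R (q + b)" using x by metis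
    also have "\<dots> = ((1 - u) *\<^sub>R p + u *\<^sub>R q) + ((1 - u) *\<^sub>R a + u *\<^sub>R b)"
      by (simp add: algebra_simps)
    finally have "x = ((1 - u) *\<^sub>R p + u *\<^sub>R q) + ((1 - u) *\<^sub>R a + u *\<^sub>R b)" .
    moreover have "(1 - u) *\<^sub>R p + u *\<^sub>R q \<in> Q" using assms(1) mem u by (intro convexD) auto
    ultimately show "x \<in> Q + (A \<inter> B)" using u(3) by (metis set_plus_intro)
  qed
qed (auto simp: set_plus_def)

lemma convex_hull_insert_zero:
  fixes K :: "'a::real_vector set"
  assumes "convex K" "K \<noteq> {}"
  shows "convex hull (insert 0 K) = {t *\<^sub>R x |t x. 0 \<le> t \<and> t \<le> 1 \<and> x \<in> K}"
  unfolding convex_hull_insert[OF assms(2)] hull_same[of convex, OF assms(1)]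
proof (intro equalityI subsetI)
  fix x assume "x \<in> {t *\<^sub>R x |t x. 0 \<le> t \<and> t \<le> 1 \<and> x \<in> K}"
  then obtain t y where "x = (1 - t) *\<^sub>R 0 + t *\<^sub>R y" "0 \<le> t" "t \<le> 1" "y \<in> K" by auto
  then show "x \<in> {x. \<exists>u\<ge>0. \<exists>v\<ge>0. \<exists>b. u + v = 1 \<and> b \<in> K \<and> x = u *\<^sub>R 0 + v *\<^sub>R b}"
    by (smt (verit) mem_Collect_eq)
next
  fix x assume "x \<in> {x. \<exists>u\<ge>0. \<exists>v\<ge>0. \<exists>b. u + v = 1 \<and> b \<in> K \<and> x = u *\<^sub>R 0 + v *\<^sub>R b}"
  then obtain v b where "x = v *\<^sub>R b" "0 \<le> v" "v \<le> 1" "b \<in> K" by auto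
  then show "x \<in> {t *\<^sub>R x |t x. 0 \<le> t \<and> t \<le> 1 \<and> x \<in> K}" by blast
qed

lemma pyramid_plus_base:
  fixes K :: "'a::real_vector set"
  assumes "convex K" "K \<noteq> {}"
  shows "convex hull (insert 0 K) + K = {t *\<^sub>R x |t x. 1 \<le> t \<and> t \<le> 2 \<and> x \<in> K}"
proof (intro equalityI subsetI)
  fix x assume "x \<in> convex hull (insert 0 K) + K"
  then obtain t y z where x: "x = t *\<^sub>R y + z" "0 \<le> t" "t \<le> 1" "y \<in> K" "z \<in> K"
    unfolding convex_hull_insert_zero[OF assms] set_plus_def by blast
  with convex_scaleR_sum_mem[OF assms(1), of t 1 y z] obtain w where "w \<in> K" "x = (t + 1) *\<^sub>R w"
    by auto
  then show "x \<in> {t *\<^sub>R x |t x. 1 \<le> t \<and> t \<le> 2 \<and> x \<in> K}" using x(2,3) by force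
next
  fix x assume "x \<in> {t *\<^sub>R x |t x. 1 \<le> t \<and> t \<le> 2 \<and> x \<in> K}"
  then obtain t y where x: "x = t *\<^sub>R y" "1 \<le> t" "t \<le> 2" "y \<in> K" by auto
  then have "x = (t - 1) *\<^sub>R y + y" by (simp add: algebra_simps)
  moreover have "(t - 1) *\<^sub>R y \<in> convex hull (insert 0 K)"
    unfolding convex_hull_insert_zero[OF assms] using x by (intro CollectI exI[of _ "t - 1"]) auto
  ultimately show "x \<in> convex hull (insert 0 K) + K" using x by (metis set_plus_intro)
qed

text \<open>
  The pyramid \<open>T\<close> consists of the multiples of points of \<open>K\<close> by factors in \<open>[0, 1]\<close>, and \<open>T + K\<close>
  of those by factors in \<open>[1, 2]\<close>. A common point of both lies, on its ray from the apex, between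
  two points of \<open>K\<close>, hence in \<open>K\<close>.
\<close>

lemma double_pyramid_decomposition:
  fixes K :: "'a::real_vector set"
  assumes "convex K" "K \<noteq> {}"
  defines "T \<equiv> convex hull (insert 0 K)"
  shows "T \<union> (T + K) = (*\<^sub>R) 2 ` T" and "T \<inter> (T + K) = K"
proof -
  note T = convex_hull_insert_zero[OF assms(1,2)] and TK = pyramid_plus_base[OF assms(1,2)]
  show "T \<union> (T + K) = (*\<^sub>R) 2 ` T"
  proof (intro equalityI subsetI)
    fix x assume "x \<in> T \<union> (T + K)"
    then have "\<exists>t y. x = t *\<^sub>R y \<and> 0 \<le> t \<and> t \<le> 2 \<and> y \<in> K"
      unfolding T_def TK unfolding T by fastforce
    then obtain t y where x: "x = t *\<^sub>R y" "0 \<le> t" "t \<le> 2" "y \<in> K" by blast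
    then have "x = 2 *\<^sub>R ((t / 2) *\<^sub>R y)" "(t / 2) *\<^sub>R y \<in> T"
      unfolding T_def T by (simp, intro CollectI exI[of _ "t / 2"]) auto
    then show "x \<in> (*\<^sub>R) 2 ` T" by blast
  next
    fix x assume "x \<in> (*\<^sub>R) 2 ` T"
    then obtain t y where x: "x = (2 * t) *\<^sub>R y" "0 \<le> t" "t \<le> 1" "y \<in> K"
      unfolding T_def T by auto
    then show "x \<in> T \<union> (T + K)"
      unfolding T_def TK unfolding T by (cases "2 * t \<le> 1") (auto 4 4 intro: exI[of _ "2 * t"])
  qed
  show "T \<inter> (T + K) = K"
  proof (intro equalityI subsetI)
    fix x assume "x \<in> T \<inter> (T + K)"
    then obtain s y t z where x: "x = s *\<^sub>R y" "0 \<le> s" "s \<le> 1" "y \<in> K"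
      "x = t *\<^sub>R z" "1 \<le> t" "t \<le> 2" "z \<in> K"
      unfolding T_def TK unfolding T by blast
    show "x \<in> K"
    proof (cases "s = t")
      case True
      then show ?thesis using x by auto
    next
      case False
      \<comment> \<open>on the ray through \<open>x\<close>, the point \<open>y = x / s\<close> lies beyond \<open>x\<close> and \<open>z = x / t\<close> before it\<close>
      with x have pos: "t - s > 0" "t > 0" by auto
      define u where "u = s * (t - 1) / (t - s)"
      define v where "v = t * (1 - s) / (t - s)"
      have "u \<ge> 0" "v \<ge> 0"
        unfolding u_def v_def using x pos
        by (auto intro!: divide_nonneg_pos mult_nonneg_nonneg
              simp del: times_divide_eq_left mult_1_right)
      moreover have "u + v = (t - s) / (t - s)"
        unfolding u_def v_def add_divide_distrib[symmetric] by (simp add: algebra_simps)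
      ultimately have uv: "u \<ge> 0" "v \<ge> 0" "u + v = 1" using pos by simp_all
      have "u *\<^sub>R y + v *\<^sub>R z = ((t - 1) / (t - s)) *\<^sub>R (s *\<^sub>R y) + ((1 - s) / (t - s)) *\<^sub>R (t *\<^sub>R z)"
        by (simp add: u_def v_def mult.commute)
      also have "\<dots> = ((t - 1) / (t - s)) *\<^sub>R x + ((1 - s) / (t - s)) *\<^sub>R x"
        using x by metis
      also have "\<dots> = x"
        using pos by (simp add: scaleR_add_left[symmetric] add_divide_distrib[symmetric])
      finally have "u *\<^sub>R y + v *\<^sub>R z = x" .
      then show ?thesis using assms(1) uv x(4,8) by (metis convexD)
    qed
  next
    fix x assume "x \<in> K"
    then show "x \<in> T \<inter> (T + K)"
      unfolding T_def TK unfolding T by (auto intro!: exI[of _ "1::real"] exI[of _ x])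
  qed
qed

text \<open>
  If a hyperplane separates a point \<open>x \<in> L - K\<close> from \<open>K\<close>, a translate of it separates \<open>x + b\<close>
  from \<open>K + B\<close>, where \<open>b\<close> is the point of \<open>B\<close> that lies furthest towards the side of \<open>x\<close>.
\<close>

lemma set_plus_cancel_subset:
  fixes K L B :: "'a::euclidean_space set"
  assumes "convex K" "compact K" "compact B" "B \<noteq> {}" and sub: "L + B \<subseteq> K + B"
  shows "L \<subseteq> K"
proof
  fix x assume x: "x \<in> L"
  show "x \<in> K"
  proof (rule ccontr)
    assume "x \<notin> K"
    then obtain a c where a: "a \<bullet> x < c" "\<And>y. y \<in> K \<Longrightarrow> a \<bullet> y > c"
      using separating_hyperplane_closed_point[of K x] assms compact_imp_closed by blast
    have "continuous_on B ((\<bullet>) a)" by (intro continuous_intros)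
    then obtain b where b: "b \<in> B" "\<And>b'. b' \<in> B \<Longrightarrow> a \<bullet> b \<le> a \<bullet> b'"
      using continuous_attains_inf[OF assms(3,4)] by blast
    have "x + b \<in> K + B" using sub x b by auto
    then obtain k b' where "x + b = k + b'" "k \<in> K" "b' \<in> B" by (auto simp: set_plus_def)
    moreover from this have "a \<bullet> x + a \<bullet> b = a \<bullet> k + a \<bullet> b'" by (metis inner_add_right)
    ultimately show False
      using a b by (metis add_le_less_mono add.commute less_trans not_less_iff_gr_or_eq)
  qed
qed

section \<open>Hausdorff convergence of convex bodies\<close>

lemma convex_bodies_set_plus: "K \<in> convex_bodies \<Longrightarrow> L \<in> convex_bodies \<Longrightarrow> K + L \<in> convex_bodies"
proof -
  assume "K \<in> convex_bodies" "L \<in> convex_bodies"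
  moreover have "K + L = {x + y |x y. x \<in> K \<and> y \<in> L}" by (auto simp: set_plus_def)
  ultimately show "K + L \<in> convex_bodies"
    using compact_sums[of K L] convex_set_plus[of K L] by (auto simp: convex_bodies_def)
qed

lemma convex_bodies_scaleR: "K \<in> convex_bodies \<Longrightarrow> (*\<^sub>R) t ` K \<in> convex_bodies"
  by (auto simp: convex_bodies_def compact_scaling convex_scaling)

lemma convex_bodies_hull: "compact A \<Longrightarrow> A \<noteq> {} \<Longrightarrow> convex hull A \<in> convex_bodies"
  by (auto simp: convex_bodies_def compact_convex_hull)

lemma convex_bodies_hull_Un: "K \<in> convex_bodies \<Longrightarrow> L \<in> convex_bodies \<Longrightarrow> convex hull (K \<union> L) \<in> convex_bodies"
  by (intro convex_bodies_hull) (auto simp: convex_bodies_def)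

lemma convex_bodies_singleton: "{x} \<in> convex_bodies"
  by (simp add: convex_bodies_def)

lemma hausdorff_dist_set_plus_le:
  assumes "K \<in> convex_bodies" "A \<in> convex_bodies" "B \<in> convex_bodies"
  shows "hausdorff_dist (K + A) (K + B) \<le> hausdorff_dist A B"
proof -
  have *: "infdist x (K + B) \<le> hausdorff_dist A B"
    if A: "A \<in> convex_bodies" and B: "B \<in> convex_bodies" and x: "x \<in> K + A" for A B x
  proof -
    from x obtain k a where k: "x = k + a" "k \<in> K" "a \<in> A" by (auto simp: set_plus_def)
    have "closed B" "B \<noteq> {}" using B compact_imp_closed by (auto simp: convex_bodies_def)
    then obtain b where b: "b \<in> B" "infdist a B = dist a b" using infdist_attains_inf by blast
    have "infdist x (K + B) \<le> dist x (k + b)" using k b by (intro infdist_le) auto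
    also have "\<dots> = infdist a B" using k b by simp
    also have "\<dots> \<le> hausdorff_dist A B" using A B k by (intro infdist_le_hausdorff_dist)
    finally show ?thesis .
  qed
  show ?thesis
    using assms *[of A B] *[of B A]
    by (intro hausdorff_dist_le) (auto simp: convex_bodies_set_plus hausdorff_dist_commute)
qed

lemma hausdorff_dist_nonneg: "0 \<le> hausdorff_dist K L"
  using Metric_space_hausdorff_dist by (rule Metric_space.nonneg)

lemma hausdorff_dist_scaleR_tendsto_0:
  assumes K: "K \<in> convex_bodies" and t: "t \<longlonglongrightarrow> 0"
  shows "(\<lambda>j. hausdorff_dist ((*\<^sub>R) (t j) ` K) {0}) \<longlonglongrightarrow> 0"
proof -
  from K obtain r where r: "\<And>x. x \<in> K \<Longrightarrow> norm x \<le> r"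
    unfolding convex_bodies_def by (metis (mono_tags, lifting) bounded_iff compact_imp_bounded mem_Collect_eq)
  from K obtain x0 where x0: "x0 \<in> K" by (auto simp: convex_bodies_def)
  have bound: "hausdorff_dist ((*\<^sub>R) s ` K) {0} \<le> \<bar>s\<bar> * r" for s
  proof (rule hausdorff_dist_le)
    fix x assume "x \<in> (*\<^sub>R) s ` K"
    then show "infdist x {0} \<le> \<bar>s\<bar> * r" using r by (auto intro!: mult_left_mono)
  next
    fix y :: "real^'a" assume y: "y \<in> {0}"
    have "infdist y ((*\<^sub>R) s ` K) \<le> dist y (s *\<^sub>R x0)" using x0 by (intro infdist_le) auto
    also have "\<dots> \<le> \<bar>s\<bar> * r" using y r[OF x0] by (auto intro!: mult_left_mono)
    finally show "infdist y ((*\<^sub>R) s ` K) \<le> \<bar>s\<bar> * r" .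
  qed (use K in \<open>auto simp: convex_bodies_scaleR convex_bodies_singleton\<close>)
  have "(\<lambda>j. \<bar>t j\<bar> * r) \<longlonglongrightarrow> 0"
    using t by (auto intro!: tendsto_mult_left_zero tendsto_rabs_zero)
  then show ?thesis
    by (rule tendsto_sandwich[OF _ _ tendsto_const, rotated 2])
       (auto simp: bound hausdorff_dist_nonneg)
qed

lemma ex_polytope_hausdorff_dist_le:
  assumes K: "K \<in> convex_bodies" and "e > 0"
  shows "\<exists>F. finite F \<and> F \<noteq> {} \<and> hausdorff_dist (convex hull F) K \<le> e"
proof -
  have cK: "compact K" "convex K" "K \<noteq> {}" using K by (auto simp: convex_bodies_def)
  obtain F where F: "finite F" "F \<subseteq> K" "K \<subseteq> (\<Union>x\<in>F. ball x e)"
    using seq_compact_imp_totally_bounded[of K] cK(1) \<open>e > 0\<close>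
    by (auto simp: compact_eq_seq_compact_metric)
  with cK have "F \<noteq> {}" by auto
  have hull: "convex hull F \<subseteq> K" using F cK by (intro hull_minimal)
  have "hausdorff_dist (convex hull F) K \<le> e"
  proof (rule hausdorff_dist_le)
    fix x assume "x \<in> convex hull F"
    with hull \<open>e > 0\<close> show "infdist x K \<le> e" by auto
  next
    fix y assume "y \<in> K"
    with F obtain x where x: "x \<in> F" "dist x y < e" by auto
    have "infdist y (convex hull F) \<le> dist y x" using x by (intro infdist_le hull_inc)
    with x show "infdist y (convex hull F) \<le> e" by (simp add: dist_commute)
  qed (use K F \<open>F \<noteq> {}\<close> in \<open>auto intro: convex_bodies_hull finite_imp_compact\<close>)
  with F \<open>F \<noteq> {}\<close> show ?thesis by blast
qed

section \<open>One-homogeneous valuations are Minkowski additive\<close>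

locale one_homogeneous_valuation =
  fixes \<phi> :: "(real ^ 'n) set \<Rightarrow> real"
  assumes Val: "\<phi> \<in> Val" and homogeneous: "one_homogeneous \<phi>"
begin

lemma scaleR: "K \<in> convex_bodies \<Longrightarrow> t \<ge> 0 \<Longrightarrow> \<phi> ((*\<^sub>R) t ` K) = t * \<phi> K"
  using homogeneous by (simp add: one_homogeneous_def)

lemma translate: "K \<in> convex_bodies \<Longrightarrow> \<phi> (K + {x}) = \<phi> K"
  using Val
  by (simp add: Val_def translation_invariant_def translation_eq_singleton_plus add.commute[of K])

lemma Un_Int:
  "K \<in> convex_bodies \<Longrightarrow> L \<in> convex_bodies \<Longrightarrow> K \<union> L \<in> convex_bodies \<Longrightarrow>
    \<phi> (K \<union> L) + \<phi> (K \<inter> L) = \<phi> K + \<phi> L"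
  using Val by (auto simp: Val_def valuation_def)

lemma tendsto:
  assumes "K \<in> convex_bodies" "\<And>j. Ks j \<in> convex_bodies" "(\<lambda>j. hausdorff_dist (Ks j) K) \<longlonglongrightarrow> 0"
  shows "(\<lambda>j::nat. \<phi> (Ks j)) \<longlonglongrightarrow> \<phi> K"
proof -
  interpret H: Metric_space "convex_bodies :: (real^'n) set set" hausdorff_dist
    by (rule Metric_space_hausdorff_dist)
  have "limitin H.mtopology Ks K sequentially"
    using assms by (simp add: H.limitin_metric_dist_null)
  moreover have "continuous_map H.mtopology euclideanreal \<phi>" using Val by (simp add: Val_def)
  ultimately have "limitin euclideanreal (\<phi> \<circ> Ks) (\<phi> K) sequentially"
    by (intro continuous_map_limit)
  then show ?thesis by (simp add: o_def)
qed

lemma tendsto_set_plus: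
  assumes "K \<in> convex_bodies" "L \<in> convex_bodies" "\<And>j. Ls j \<in> convex_bodies"
    and "(\<lambda>j. hausdorff_dist (Ls j) L) \<longlonglongrightarrow> 0"
  shows "(\<lambda>j::nat. \<phi> (K + Ls j)) \<longlonglongrightarrow> \<phi> (K + L)"
proof (rule tendsto)
  show "(\<lambda>j. hausdorff_dist (K + Ls j) (K + L)) \<longlonglongrightarrow> 0"
    by (rule tendsto_sandwich[OF _ _ tendsto_const assms(4)])
       (use assms in \<open>auto simp: hausdorff_dist_nonneg hausdorff_dist_set_plus_le\<close>)
qed (use assms in \<open>auto simp: convex_bodies_set_plus\<close>)

lemma singleton: "\<phi> {x} = 0"
proof -
  have "\<phi> ((*\<^sub>R) 0 ` {0}) = 0" using scaleR[of "{0}" 0] by (simp add: convex_bodies_singleton)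
  then show ?thesis using translate[of "{0}" x]
    by (simp add: convex_bodies_singleton set_plus_def)
qed

definition additive_summand :: "(real ^ 'n) set \<Rightarrow> bool" where
  "additive_summand P \<longleftrightarrow>
     P \<in> convex_bodies \<and> (\<forall>Q\<in>convex_bodies. \<phi> (Q + P) = \<phi> Q + \<phi> P)"

lemma additive_summand_singleton: "additive_summand {x}"
  by (simp add: additive_summand_def convex_bodies_singleton translate singleton)

lemma additive_summand_translate:
  assumes "additive_summand P"
  shows "additive_summand (P + {x})"
  unfolding additive_summand_def
proof (intro conjI ballI)
  have P: "P \<in> convex_bodies" using assms by (simp add: additive_summand_def)
  then show "P + {x} \<in> convex_bodies" by (simp add: convex_bodies_set_plus convex_bodies_singleton)
  fix Q :: "(real^'n) set" assume Q: "Q \<in> convex_bodies"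
  have "\<phi> (Q + (P + {x})) = \<phi> (Q + P)"
    using translate[of "Q + P" x] P Q by (simp add: convex_bodies_set_plus add.assoc)
  then show "\<phi> (Q + (P + {x})) = \<phi> Q + \<phi> (P + {x})"
    using assms P Q by (simp add: additive_summand_def translate)
qed

text \<open>
  The decomposition of \<open>2 T\<close> shows that adding \<open>2 T\<close> to a body \<open>Q\<close> raises \<open>\<phi>\<close> by twice as much
  as adding \<open>T\<close>; homogeneity moves the factor from \<open>T\<close> to \<open>Q\<close>, which can then be shrunk to a
  point.
\<close>

lemma additive_summand_pyramid_zero:
  assumes "additive_summand K"
  shows "additive_summand (convex hull (insert 0 K))"
proof -
  define T where "T = convex hull (insert 0 K)"
  have K: "K \<in> convex_bodies" and add: "\<And>Q. Q \<in> convex_bodies \<Longrightarrow> \<phi> (Q + K) = \<phi> Q + \<phi> K"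
    using assms by (auto simp: additive_summand_def)
  then have cK: "convex K" "K \<noteq> {}" "compact K" by (auto simp: convex_bodies_def)
  have T: "T \<in> convex_bodies"
    unfolding T_def using cK by (intro convex_bodies_hull) auto
  note dec = double_pyramid_decomposition[OF cK(1,2), folded T_def]
  have double: "\<phi> (Q + (*\<^sub>R) 2 ` T) - \<phi> Q = 2 * (\<phi> (Q + T) - \<phi> Q)" if Q: "Q \<in> convex_bodies" for Q
  proof -
    have "(Q + T) \<inter> (Q + (T + K)) = Q + (T \<inter> (T + K))"
      using T Q convex_bodies_set_plus[OF T K] convex_bodies_scaleR[OF T, of 2]
      by (intro set_plus_Int_of_convex_Un) (auto simp: dec(1) convex_bodies_def compact_imp_closed)
    then have "(Q + T) \<inter> (Q + (T + K)) = Q + K" by (simp only: dec(2))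
    moreover have "(Q + T) \<union> (Q + (T + K)) = Q + (*\<^sub>R) 2 ` T"
      by (metis dec(1) set_plus_Un)
    moreover have "Q + (T + K) = (Q + T) + K" by (simp add: add.assoc)
    ultimately have "\<phi> (Q + (*\<^sub>R) 2 ` T) + \<phi> (Q + K) = \<phi> (Q + T) + \<phi> ((Q + T) + K)"
      using Un_Int[of "Q + T" "Q + (T + K)"] T K Q
      by (simp add: convex_bodies_set_plus convex_bodies_scaleR)
    then show ?thesis using add[OF Q] add[of "Q + T"] Q T by (simp add: convex_bodies_set_plus)
  qed
  \<comment> \<open>apply \<open>double\<close> to \<open>Q\<close> and pull the factor \<open>2\<close> out of \<open>Q + 2 T = 2 (Q / 2 + T)\<close>\<close>
  have half: "\<phi> ((*\<^sub>R) (1/2) ` Q + T) - \<phi> ((*\<^sub>R) (1/2) ` Q) = \<phi> (Q + T) - \<phi> Q"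
    if Q: "Q \<in> convex_bodies" for Q
  proof -
    let ?H = "(*\<^sub>R) (1/2) ` Q"
    have H: "?H \<in> convex_bodies" using Q by (rule convex_bodies_scaleR)
    have Q2: "Q = (*\<^sub>R) 2 ` ?H" by (simp add: scaleR_image_scaleR_image scaleR_image_one)
    have "\<phi> (Q + (*\<^sub>R) 2 ` T) = 2 * \<phi> (?H + T)"
      using scaleR[of "?H + T" 2] H T Q2
      by (metis convex_bodies_set_plus scaleR_image_set_plus zero_le_numeral)
    moreover have "\<phi> Q = 2 * \<phi> ?H" using scaleR[OF Q, of "1/2"] by simp
    ultimately show ?thesis using double[OF Q] by simp
  qed
  have "\<phi> (Q + T) = \<phi> Q + \<phi> T" if Q: "Q \<in> convex_bodies" for Q
  proof -
    define Qs where "Qs j = (*\<^sub>R) ((1/2)^j) ` Q" for j :: nat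
    have Qs: "Qs j \<in> convex_bodies" for j using Q by (simp add: Qs_def convex_bodies_scaleR)
    have const: "\<phi> (Qs j + T) - \<phi> (Qs j) = \<phi> (Q + T) - \<phi> Q" for j
    proof (induction j)
      case 0
      show ?case by (simp add: Qs_def scaleR_image_one)
    next
      case (Suc j)
      have "Qs (Suc j) = (*\<^sub>R) (1/2) ` Qs j"
        by (simp add: Qs_def scaleR_image_scaleR_image)
      then show ?case using half[OF Qs[of j]] Suc by simp
    qed
    have lim: "(\<lambda>j. hausdorff_dist (Qs j) {0}) \<longlonglongrightarrow> 0"
      unfolding Qs_def using Q by (rule hausdorff_dist_scaleR_tendsto_0) (simp add: LIMSEQ_realpow_zero)
    have "(\<lambda>j. \<phi> (T + Qs j) - \<phi> (Qs j)) \<longlonglongrightarrow> \<phi> (T + {0}) - \<phi> {0}"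
      using Qs T lim convex_bodies_singleton by (intro tendsto_diff tendsto_set_plus tendsto)
    then have "(\<lambda>j. \<phi> (Q + T) - \<phi> Q) \<longlonglongrightarrow> \<phi> T"
      using const T by (simp add: translate singleton add.commute[of T])
    then show ?thesis by (simp add: LIMSEQ_const_iff)
  qed
  with T show ?thesis by (simp add: additive_summand_def T_def)
qed

lemma additive_summand_pyramid:
  assumes "additive_summand K"
  shows "additive_summand (convex hull (insert a K))"
proof -
  have "insert a K = insert 0 (K + {-a}) + {a}"
    by (auto simp: set_plus_def)
  then have "convex hull (insert a K) = convex hull (insert 0 (K + {-a})) + {a}"
    by (metis convex_hull_set_plus convex_hull_singleton)
  then show ?thesis
    using assms by (metis additive_summand_translate additive_summand_pyramid_zero)
qed

lemma additive_summand_polytope: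
  assumes "finite F" "F \<noteq> {}"
  shows "additive_summand (convex hull F)"
  using assms
proof (induction rule: finite_ne_induct)
  case (singleton x)
  show ?case by (simp add: additive_summand_singleton)
next
  case (insert x F)
  have "convex hull (insert x F) = convex hull (insert x (convex hull F))"
    by (metis hull_insert)
  then show ?case using insert by (simp add: additive_summand_pyramid)
qed

theorem set_plus:
  assumes K: "K \<in> convex_bodies" and L: "L \<in> convex_bodies"
  shows "\<phi> (K + L) = \<phi> K + \<phi> L"
proof -
  have "\<exists>F. finite F \<and> F \<noteq> {} \<and> hausdorff_dist (convex hull F) L \<le> 1 / real (Suc j)" for j
    using L by (intro ex_polytope_hausdorff_dist_le) auto
  then obtain F where F: "\<And>j. finite (F j)" "\<And>j. F j \<noteq> {}"
    "\<And>j. hausdorff_dist (convex hull F j) L \<le> 1 / real (Suc j)"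
    by metis
  define P where "P j = convex hull F j" for j
  have P: "P j \<in> convex_bodies" "\<phi> (K + P j) = \<phi> K + \<phi> (P j)" for j
    using additive_summand_polytope[OF F(1,2)[of j]] K by (auto simp: P_def additive_summand_def)
  have lim: "(\<lambda>j. hausdorff_dist (P j) L) \<longlonglongrightarrow> 0"
    by (rule tendsto_sandwich[OF _ _ tendsto_const LIMSEQ_Suc[OF lim_1_over_n]])
       (use F(3) in \<open>auto simp: hausdorff_dist_nonneg P_def\<close>)
  have "(\<lambda>j. \<phi> (K + P j)) \<longlonglongrightarrow> \<phi> (K + L)"
    using K L P lim by (intro tendsto_set_plus)
  moreover have "(\<lambda>j. \<phi> K + \<phi> (P j)) \<longlonglongrightarrow> \<phi> K + \<phi> L"
    using L P lim by (intro tendsto_add tendsto_const tendsto)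
  ultimately show ?thesis using P(2) LIMSEQ_unique by auto
qed

end

section \<open>The join-deviation as an intrinsic metric\<close>

locale monotone_one_homogeneous_valuation = one_homogeneous_valuation \<phi>
  for \<phi> :: "(real ^ 'n) set \<Rightarrow> real" +
  assumes mono_strict: "K \<in> convex_bodies \<Longrightarrow> L \<in> convex_bodies \<Longrightarrow> K \<subset> L \<Longrightarrow> \<phi> K < \<phi> L"
begin

lemma mono: "K \<in> convex_bodies \<Longrightarrow> L \<in> convex_bodies \<Longrightarrow> K \<subseteq> L \<Longrightarrow> \<phi> K \<le> \<phi> L"
  using mono_strict[of K L] by (cases "K = L") (auto simp: psubset_eq)

lemma le_hull_Un:
  assumes "K \<in> convex_bodies" "L \<in> convex_bodies"
  shows "\<phi> K \<le> \<phi> (convex hull (K \<union> L))"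
  using assms hull_subset[of "K \<union> L" convex] by (intro mono) (auto intro: convex_bodies_hull_Un)

text \<open>
  In terms of support functions this is \<open>max a c + b \<le> max a b + max b c\<close>.
\<close>

lemma hull_Un_triangle:
  assumes K: "K \<in> convex_bodies" and L: "L \<in> convex_bodies" and M: "M \<in> convex_bodies"
  shows "\<phi> (convex hull (K \<union> M)) + \<phi> L \<le> \<phi> (convex hull (K \<union> L)) + \<phi> (convex hull (L \<union> M))"
proof -
  have cL: "convex L" using L by (simp add: convex_bodies_def)
  let ?S = "convex hull (K \<union> L) + convex hull (L \<union> M)"
  have S: "?S \<in> convex_bodies" using K L M by (intro convex_bodies_set_plus convex_bodies_hull_Un)
  have "K + L \<subseteq> ?S"
    by (intro set_plus_mono2 order_trans[OF _ hull_subset]) auto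
  moreover have "M + L \<subseteq> ?S"
    by (subst add.commute, intro set_plus_mono2 order_trans[OF _ hull_subset]) auto
  ultimately have "convex hull ((K + L) \<union> (M + L)) \<subseteq> ?S"
    using S by (intro hull_minimal) (auto simp: convex_bodies_def)
  then have "convex hull (K \<union> M) + L \<subseteq> ?S"
    by (simp add: convex_hull_Un_set_plus cL)
  then have "\<phi> (convex hull (K \<union> M) + L) \<le> \<phi> ?S"
    using K L M S by (intro mono convex_bodies_set_plus convex_bodies_hull_Un)
  then show ?thesis using K L M by (simp add: set_plus convex_bodies_hull_Un)
qed

lemma Metric_space_join_deviation: "Metric_space convex_bodies (join_deviation \<phi>)"
proof
  fix K L :: "(real^'n) set"
  show "0 \<le> join_deviation \<phi> K L"
    using le_hull_Un[of K L] le_hull_Un[of L K] by (auto simp: join_deviation_def Un_commute)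
  show "join_deviation \<phi> K L = join_deviation \<phi> L K"
    by (simp add: join_deviation_def Un_commute)
next
  fix K L :: "(real^'n) set"
  assume KL: "K \<in> convex_bodies" "L \<in> convex_bodies"
  show "join_deviation \<phi> K L = 0 \<longleftrightarrow> K = L"
  proof
    assume "join_deviation \<phi> K L = 0"
    then have "\<phi> (convex hull (K \<union> L)) \<le> \<phi> K" "\<phi> (convex hull (K \<union> L)) \<le> \<phi> L"
      using KL le_hull_Un[of K L] le_hull_Un[of L K] by (auto simp: join_deviation_def Un_commute)
    then have "K = convex hull (K \<union> L)" "L = convex hull (K \<union> L)"
      using mono_strict[OF _ convex_bodies_hull_Un[OF KL]] KL hull_subset[of "K \<union> L" convex]
      by (metis Un_subset_iff not_less psubsetI)+
    then show "K = L" by simp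
  next
    assume "K = L"
    then show "join_deviation \<phi> K L = 0"
      using KL by (simp add: join_deviation_def convex_bodies_def hull_same)
  qed
next
  fix K L M :: "(real^'n) set"
  assume "K \<in> convex_bodies" "L \<in> convex_bodies" "M \<in> convex_bodies"
  then show "join_deviation \<phi> K M \<le> join_deviation \<phi> K L + join_deviation \<phi> L M"
    using hull_Un_triangle[of K L M] by (simp add: join_deviation_def)
qed

lemma join_deviation_set_plus_right:
  assumes "A \<in> convex_bodies" "B \<in> convex_bodies" "C \<in> convex_bodies"
  shows "join_deviation \<phi> (A + C) (B + C) = join_deviation \<phi> A B"
proof -
  have "convex hull ((A + C) \<union> (B + C)) = convex hull (A \<union> B) + C"
    using assms by (intro convex_hull_Un_set_plus) (simp add: convex_bodies_def)
  then show ?thesis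
    using assms by (simp add: join_deviation_def set_plus convex_bodies_set_plus convex_bodies_hull_Un)
qed

lemma join_deviation_scaleR:
  assumes "A \<in> convex_bodies" "B \<in> convex_bodies" "t \<ge> 0"
  shows "join_deviation \<phi> ((*\<^sub>R) t ` A) ((*\<^sub>R) t ` B) = t * join_deviation \<phi> A B"
proof -
  have "convex hull ((*\<^sub>R) t ` A \<union> (*\<^sub>R) t ` B) = (*\<^sub>R) t ` (convex hull (A \<union> B))"
    by (simp add: image_Un[symmetric] convex_hull_scaling)
  then show ?thesis
    using assms
    by (simp add: join_deviation_def scaleR convex_bodies_scaleR convex_bodies_hull_Un algebra_simps)
qed

definition minkowski_segment :: "(real^'n) set \<Rightarrow> (real^'n) set \<Rightarrow> real \<Rightarrow> (real^'n) set" where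
  "minkowski_segment K L t = (*\<^sub>R) (1 - t) ` K + (*\<^sub>R) t ` L"

lemma join_deviation_minkowski_segment:
  assumes K: "K \<in> convex_bodies" and L: "L \<in> convex_bodies" and st: "0 \<le> s" "s \<le> t" "t \<le> 1"
  shows "join_deviation \<phi> (minkowski_segment K L s) (minkowski_segment K L t) =
    (t - s) * join_deviation \<phi> K L"
proof -
  \<comment> \<open>the summand that the two points of the segment have in common\<close>
  let ?C = "(*\<^sub>R) (1 - t) ` K + (*\<^sub>R) s ` L"
  have c: "convex K" "convex L" using K L by (auto simp: convex_bodies_def)
  have "(*\<^sub>R) (1 - s) ` K = (*\<^sub>R) (t - s) ` K + (*\<^sub>R) (1 - t) ` K"
    using scaleR_image_add[OF c(1), of "t - s" "1 - t"] st by simp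
  moreover have "(*\<^sub>R) t ` L = (*\<^sub>R) (t - s) ` L + (*\<^sub>R) s ` L"
    using scaleR_image_add[OF c(2), of "t - s" s] st by simp
  ultimately have "minkowski_segment K L s = (*\<^sub>R) (t - s) ` K + ?C"
    "minkowski_segment K L t = (*\<^sub>R) (t - s) ` L + ?C"
    by (simp_all add: minkowski_segment_def ac_simps)
  then show ?thesis
    using K L st
    by (simp add: join_deviation_set_plus_right join_deviation_scaleR convex_bodies_set_plus convex_bodies_scaleR)
qed

lemma ex_constant_speed_path:
  assumes K: "K \<in> convex_bodies" and L: "L \<in> convex_bodies"
  shows "\<exists>\<gamma>. \<gamma> 0 = K \<and> \<gamma> 1 = L \<and> (\<forall>t\<in>{0..1}. \<gamma> t \<in> convex_bodies) \<and>
     (\<forall>s t. 0 \<le> s \<longrightarrow> s \<le> t \<longrightarrow> t \<le> 1 \<longrightarrow>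
        join_deviation \<phi> (\<gamma> s) (\<gamma> t) = (t - s) * join_deviation \<phi> K L)"
proof (intro exI conjI ballI allI impI)
  have ne: "K \<noteq> {}" "L \<noteq> {}" using K L by (auto simp: convex_bodies_def)
  show "minkowski_segment K L 0 = K" "minkowski_segment K L 1 = L"
    unfolding minkowski_segment_def
    by (simp_all only: scaleR_image_zero ne scaleR_image_one diff_zero diff_self
          add_0_left add_0_right not_False_eq_True)
  show "minkowski_segment K L t \<in> convex_bodies" for t
    using K L by (simp add: minkowski_segment_def convex_bodies_set_plus convex_bodies_scaleR)
qed (use K L in \<open>simp add: join_deviation_minkowski_segment\<close>)

end

text \<open>
  Adding the unit ball lifts any two bodies into the range where strict monotonicity is assumed.
\<close>

lemma (in one_homogeneous_valuation) monotone_if_strictly_monotone: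
  assumes k: "k \<le> CARD('n)" and mono: "strictly_monotone k \<phi>"
  shows "monotone_one_homogeneous_valuation \<phi>"
proof
  fix K L :: "(real^'n) set"
  assume K: "K \<in> convex_bodies" and L: "L \<in> convex_bodies" and KL: "K \<subset> L"
  define B :: "(real^'n) set" where "B = cball 0 1"
  have B: "B \<in> convex_bodies" by (simp add: B_def convex_bodies_def)
  have full: "A + B \<in> convex_bodies_dim_ge k" if A: "A \<in> convex_bodies" for A
  proof -
    from A obtain a where "a \<in> A" by (auto simp: convex_bodies_def)
    then have "{a} + B \<subseteq> A + B" by (intro set_plus_mono2) auto
    moreover have "{a} + B = cball a 1"
      using translation_eq_singleton_plus[of a B] by (simp add: B_def cball_translation)
    ultimately have "aff_dim (cball a 1) \<le> aff_dim (A + B)" by (metis aff_dim_subset)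
    moreover have "aff_dim (cball a 1) = int CARD('n)"
      by (subst aff_dim_cball) auto
    ultimately show ?thesis
      using A B k by (simp add: convex_bodies_dim_ge_def convex_bodies_set_plus)
  qed
  have "\<not> L + B \<subseteq> K + B"
    using set_plus_cancel_subset[of K B L] K B KL by (auto simp: convex_bodies_def)
  moreover have "K + B \<subseteq> L + B" using KL by (intro set_plus_mono2) auto
  ultimately have "K + B \<subset> L + B" by auto
  then have "\<phi> (K + B) < \<phi> (L + B)"
    using mono full K L by (simp add: strictly_monotone_def)
  then show "\<phi> K < \<phi> L" using K L B by (simp add: set_plus)
qed

theorem theorem1p3:
  fixes \<phi> :: "(real ^ 'n) set \<Rightarrow> real" and k :: nat
  assumes "1 \<le> k" and "k \<le> CARD('n)"
    and "\<phi> \<in> Val"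
    and "strictly_monotone k \<phi>"
    and "one_homogeneous \<phi>"
  shows "Metric_space convex_bodies (join_deviation \<phi>)
    \<and> Metric_space.length_space convex_bodies (join_deviation \<phi>)
    \<and> (\<forall>K\<in>convex_bodies. \<forall>L\<in>convex_bodies. \<exists>a b \<gamma>.
         Metric_space.shortest_path convex_bodies (join_deviation \<phi>) a b \<gamma> K L)"
proof -
  interpret one_homogeneous_valuation \<phi>
    using assms by unfold_locales
  interpret monotone_one_homogeneous_valuation \<phi>
    using assms by (intro monotone_if_strictly_monotone)
  interpret J: Metric_space convex_bodies "join_deviation \<phi>"
    by (rule Metric_space_join_deviation)
  show ?thesis
    using J.Metric_space_axioms J.length_space_if_constant_speed_paths[OF ex_constant_speed_path]
    by blast
qed

end
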